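(* Let $N\ge1$, $1<p,q<\infty$, $\alpha,\beta>0$ with $\frac{\alpha}{p}+\frac{\beta}{q}=1$. For $t>0$ let $Q_t=(0,t)^N$ be the cube of side length $t$, and let $\lambda_1^t(p,q)$ be the first Dirichlet eigenvalue of the system $$-\Delta_p u=\lambda\alpha|u|^{\alpha-2}u|v|^\beta,\qquad -\Delta_q v=\lambda\beta|u|^\alpha|v|^{\beta-2}v\quad\text{in }Q_t,\qquad u=v=0\text{ on }\partial Q_t.$$ Then $t^{\alpha+\beta}\lambda_1^t(p,q)=\lambda_1^1(p,q)$ for every $t>0$.
   Context: $\Delta_r u=\operatorname{div}(|\nabla u|^{r-2}\nabla u)$. $\lambda_1^t(p,q)$ is the infimum over $(u,v)\in W^{1,p}_0(Q_t)\times W^{1,q}_0(Q_t)$ with $\int_{Q_t}|u|^\alpha|v|^\beta>0$ of $\big(\frac1p\int_{Q_t}|\nabla u|^p+\frac1q\int_{Q_t}|\nabla v|^q\big)/\int_{Q_t}|u|^\alpha|v|^\beta$. *)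

theory Defs
  imports "HOL-Analysis.Analysis"
begin

text \<open>C^k functions on the whole space: continuous, and for k+1 differentiable with all
 partial derivatives of class C^k.\<close>
fun Ck :: "nat \<Rightarrow> ('a::euclidean_space \<Rightarrow> real) \<Rightarrow> bool" where
  "Ck 0 f = continuous_on UNIV f"
| "Ck (Suc k) f = (f differentiable_on UNIV \<and>
      (\<forall>i\<in>Basis. Ck k (\<lambda>x. frechet_derivative f (at x) i)))"

definition Cinf :: "('a::euclidean_space \<Rightarrow> real) \<Rightarrow> bool" where
  "Cinf f \<longleftrightarrow> (\<forall>k. Ck k f)"

text \<open>Test functions C_c^infinity(Omega): smooth with compact support contained in Omega.\<close>
definition test_fun :: "'a::euclidean_space set \<Rightarrow> ('a \<Rightarrow> real) \<Rightarrow> bool" where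
  "test_fun \<Omega> \<phi> \<longleftrightarrow> Cinf \<phi> \<and> compact (closure {x. \<phi> x \<noteq> 0})
      \<and> closure {x. \<phi> x \<noteq> 0} \<subseteq> \<Omega>"

text \<open>Classical gradient.\<close>
definition grad :: "('a::euclidean_space \<Rightarrow> real) \<Rightarrow> 'a \<Rightarrow> 'a" where
  "grad \<phi> x = (\<Sum>i\<in>Basis. frechet_derivative \<phi> (at x) i *\<^sub>R i)"

text \<open>g is a weak gradient of u on Omega.\<close>
definition weak_grad :: "'a::euclidean_space set \<Rightarrow> ('a \<Rightarrow> real) \<Rightarrow> ('a \<Rightarrow> 'a) \<Rightarrow> bool" where
  "weak_grad \<Omega> u g \<longleftrightarrow> (\<forall>\<phi>. test_fun \<Omega> \<phi> \<longrightarrow> (\<forall>i\<in>Basis.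
      set_integrable lebesgue \<Omega> (\<lambda>x. u x * frechet_derivative \<phi> (at x) i) \<and>
      set_integrable lebesgue \<Omega> (\<lambda>x. (g x \<bullet> i) * \<phi> x) \<and>
      (LINT x:\<Omega>|lebesgue. u x * frechet_derivative \<phi> (at x) i)
        = - (LINT x:\<Omega>|lebesgue. (g x \<bullet> i) * \<phi> x)))"

text \<open>u in L^p(Omega) (real-valued) and vector fields in L^p(Omega).\<close>
definition Lp :: "'a::euclidean_space set \<Rightarrow> real \<Rightarrow> ('a \<Rightarrow> 'b::euclidean_space) \<Rightarrow> bool" where
  "Lp \<Omega> p f \<longleftrightarrow> set_borel_measurable lebesgue \<Omega> f \<and>
      set_integrable lebesgue \<Omega> (\<lambda>x. norm (f x) powr p)"

text \<open>(u,g) in W^{1,p}(Omega), g being the weak gradient of u.\<close>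
definition W1p :: "'a::euclidean_space set \<Rightarrow> real \<Rightarrow> ('a \<Rightarrow> real) \<Rightarrow> ('a \<Rightarrow> 'a) \<Rightarrow> bool" where
  "W1p \<Omega> p u g \<longleftrightarrow> Lp \<Omega> p u \<and> Lp \<Omega> p g \<and> weak_grad \<Omega> u g"

text \<open>(u,g) in W_0^{1,p}(Omega): closure of C_c^infinity(Omega) in the W^{1,p} norm.\<close>
definition W01p :: "'a::euclidean_space set \<Rightarrow> real \<Rightarrow> ('a \<Rightarrow> real) \<Rightarrow> ('a \<Rightarrow> 'a) \<Rightarrow> bool" where
  "W01p \<Omega> p u g \<longleftrightarrow> W1p \<Omega> p u g \<and>
     (\<exists>\<phi>::nat \<Rightarrow> 'a \<Rightarrow> real. (\<forall>n. test_fun \<Omega> (\<phi> n)) \<and>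
        ((\<lambda>n. (LINT x:\<Omega>|lebesgue. \<bar>\<phi> n x - u x\<bar> powr p)
             + (LINT x:\<Omega>|lebesgue. norm (grad (\<phi> n) x - g x) powr p)) \<longlonglongrightarrow> 0))"

text \<open>First eigenvalue lambda_1(p,q) on Omega, as the infimum of the Rayleigh quotient.\<close>
definition lambda1 :: "'a::euclidean_space set \<Rightarrow> real \<Rightarrow> real \<Rightarrow> real \<Rightarrow> real \<Rightarrow> real" where
  "lambda1 \<Omega> p q \<alpha> \<beta> = Inf {((1/p) * (LINT x:\<Omega>|lebesgue. norm (gu x) powr p)
        + (1/q) * (LINT x:\<Omega>|lebesgue. norm (gv x) powr q))
        / (LINT x:\<Omega>|lebesgue. \<bar>u x\<bar> powr \<alpha> * \<bar>v x\<bar> powr \<beta>) | u gu v gv.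
      W01p \<Omega> p u gu \<and> W01p \<Omega> q v gv \<and>
      (LINT x:\<Omega>|lebesgue. \<bar>u x\<bar> powr \<alpha> * \<bar>v x\<bar> powr \<beta>) > 0}"

text \<open>The open cube Q_t = (0,t)^N.\<close>
definition cube :: "real \<Rightarrow> 'a::euclidean_space set" where
  "cube t = box 0 (t *\<^sub>R One)"

end

theory Submission
  imports Defs "HOL-Computational_Algebra.Polynomial"
begin

text \<open>The dilation \<open>x \<mapsto> t x\<close> maps \<open>Q_1\<close> onto \<open>Q_t\<close>, and \<open>u \<mapsto> t u(x/t)\<close> maps
  \<open>W_0^{1,p}(Q_1)\<close> onto \<open>W_0^{1,p}(Q_t)\<close> while keeping the values of the gradient. Hence both
  Dirichlet energies acquire the factor \<open>t^N\<close> and the coupling integral \<open>\<integral>|u|^\<alpha>|v|^\<beta>\<close>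
  the factor \<open>t^(N+\<alpha>+\<beta>)\<close>, so the Rayleigh quotients on \<open>Q_t\<close> are those on \<open>Q_1\<close> divided
  by \<open>t^(\<alpha>+\<beta>)\<close>. Passing to infima needs this set to be nonempty (the infimum of the empty
  set of reals is unspecified). A smooth bump \<open>exp (-1/(r^2 - |x - c|^2))\<close> is a witness; that
  its classical gradient is a weak gradient is integration by parts, i.e. \<open>\<integral>\<partial>_i h = 0\<close> for
  compactly supported \<open>C^1\<close> functions \<open>h\<close>, shown by dominated convergence of difference
  quotients.\<close>

section \<open>Smoothness classes\<close>

lemma Ck_imp_continuous_on: "Ck k f \<Longrightarrow> continuous_on UNIV f"
  by (cases k) (auto intro: differentiable_imp_continuous_on)

lemma Ck_Suc_imp_Ck: "Ck (Suc k) f \<Longrightarrow> Ck k f"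
proof (induction k arbitrary: f)
  case 0
  then show ?case by (auto intro: differentiable_imp_continuous_on)
next
  case (Suc k)
  then show ?case by (metis Ck.simps(2))
qed

lemma Ck_SucI:
  assumes "\<And>x. (f has_derivative f' x) (at x)"
    and "\<And>i. i \<in> Basis \<Longrightarrow> Ck k (\<lambda>x. f' x i)"
  shows "Ck (Suc k) f"
proof -
  have "f differentiable_on UNIV"
    using assms(1) unfolding differentiable_on_def differentiable_def by blast
  moreover have "(\<lambda>x. frechet_derivative f (at x) i) = (\<lambda>x. f' x i)" for i
    using frechet_derivative_at[OF assms(1)] by auto
  ultimately show ?thesis using assms(2) by simp
qed

lemma Ck_SucD:
  assumes "Ck (Suc k) f"
  shows "(f has_derivative frechet_derivative f (at x)) (at x)"
    and "i \<in> Basis \<Longrightarrow> Ck k (\<lambda>x. frechet_derivative f (at x) i)"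
  using assms by (auto simp: differentiable_on_def frechet_derivative_works[symmetric])

lemma Cinf_imp_Ck: "Cinf f \<Longrightarrow> Ck k f"
  by (simp add: Cinf_def)

lemma Ck_const: "Ck k (\<lambda>x. a)"
proof (induction k arbitrary: a)
  case (Suc k)
  show ?case by (rule Ck_SucI[where f'="\<lambda>x h. 0"]) (auto intro: derivative_eq_intros Suc)
qed simp

lemma Ck_add: "Ck k f \<Longrightarrow> Ck k g \<Longrightarrow> Ck k (\<lambda>x. f x + g x)"
proof (induction k arbitrary: f g)
  case 0
  then show ?case by (auto intro: continuous_intros)
next
  case (Suc k)
  show ?case
    by (rule Ck_SucI[where f'="\<lambda>x h. frechet_derivative f (at x) h + frechet_derivative g (at x) h"])
      (use Ck_SucD[OF Suc.prems(1)] Ck_SucD[OF Suc.prems(2)] Suc.IH in \<open>auto intro!: derivative_eq_intros\<close>)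
qed

lemma Ck_mult: "Ck k f \<Longrightarrow> Ck k g \<Longrightarrow> Ck k (\<lambda>x. f x * g x)"
proof (induction k arbitrary: f g)
  case 0
  then show ?case by (auto intro: continuous_intros)
next
  case (Suc k)
  note f = Suc.prems(1) and g = Suc.prems(2)
  show ?case
    by (rule Ck_SucI[where f'="\<lambda>x h. f x * frechet_derivative g (at x) h + frechet_derivative f (at x) h * g x"])
      (use Ck_SucD[OF f] Ck_SucD[OF g] Ck_Suc_imp_Ck[OF f] Ck_Suc_imp_Ck[OF g]
        in \<open>auto intro!: derivative_eq_intros Suc.IH Ck_add\<close>)
qed

lemma Ck_affine: "Ck k (\<lambda>x. a + x \<bullet> w)"
proof (cases k)
  case (Suc m)
  have "Ck (Suc m) (\<lambda>x. a + x \<bullet> w)"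
    by (rule Ck_SucI[where f'="\<lambda>x h. h \<bullet> w"]) (auto intro!: derivative_eq_intros Ck_const)
  then show ?thesis using Suc by simp
qed (simp add: continuous_intros)

definition derivative_tower :: "(nat \<Rightarrow> real \<Rightarrow> real) \<Rightarrow> bool" where
  "derivative_tower D \<longleftrightarrow> (\<forall>n x. (D n has_real_derivative D (Suc n) x) (at x))"

lemma Ck_compose_derivative_tower:
  "derivative_tower D \<Longrightarrow> Ck k g \<Longrightarrow> Ck k (\<lambda>x. D 0 (g x))"
proof (induction k arbitrary: D g)
  case 0
  have "continuous_on UNIV (D 0)"
    using 0(1) unfolding derivative_tower_def by (meson DERIV_isCont continuous_at_imp_continuous_on)
  then show ?case using 0(2) by (auto intro: continuous_on_compose2)
next
  case (Suc k)
  have shift: "derivative_tower (\<lambda>n. D (Suc n))"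
    using Suc.prems(1) by (simp add: derivative_tower_def)
  have "(D 0 has_derivative (\<lambda>h. D 1 y * h)) (at y)" for y
    using Suc.prems(1) by (simp add: derivative_tower_def has_field_derivative_def)
  then show ?case
    using Suc.IH[OF shift Ck_Suc_imp_Ck[OF Suc.prems(2)]] Ck_SucD[OF Suc.prems(2)]
    by (intro Ck_SucI[where f'="\<lambda>x h. D 1 (g x) * frechet_derivative g (at x) h"]
        has_derivative_compose[OF Ck_SucD(1)[OF Suc.prems(2)]] Ck_mult) auto
qed

lemma has_derivative_scale_comp:
  assumes "(f has_derivative f') (at (c *\<^sub>R y))"
  shows "((\<lambda>y. b * f (c *\<^sub>R y)) has_derivative (\<lambda>h. (b * c) * f' h)) (at y)"
proof -
  have "((\<lambda>y. f (c *\<^sub>R y)) has_derivative (\<lambda>h. f' (c *\<^sub>R h))) (at y)"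
    using has_derivative_compose[of "\<lambda>y. c *\<^sub>R y" "\<lambda>h. c *\<^sub>R h" y UNIV f, OF _ assms]
    by (simp add: bounded_linear_scaleR_right bounded_linear_imp_has_derivative)
  then have "((\<lambda>y. b * f (c *\<^sub>R y)) has_derivative (\<lambda>h. b * f' (c *\<^sub>R h))) (at y)"
    by (auto intro!: derivative_eq_intros)
  then show ?thesis
    using linear_cmul[OF has_derivative_linear[OF assms]] by (simp add: mult.assoc)
qed

lemma Ck_scale_comp: "Ck k f \<Longrightarrow> Ck k (\<lambda>y. b * f (c *\<^sub>R y))"
proof (induction k arbitrary: f b)
  case 0
  then show ?case
    by (auto intro!: continuous_intros intro: continuous_on_compose2[OF Ck_imp_continuous_on[OF 0]])
next
  case (Suc k)
  show ?case
    by (rule Ck_SucI[where f'="\<lambda>y h. (b * c) * frechet_derivative f (at (c *\<^sub>R y)) h"])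
      (use has_derivative_scale_comp[OF Ck_SucD(1)[OF Suc.prems]] Suc.IH[OF Ck_SucD(2)[OF Suc.prems]] in auto)
qed

section \<open>A flat function and bump functions\<close>

fun flat_poly :: "nat \<Rightarrow> real poly" where
  "flat_poly 0 = 1"
| "flat_poly (Suc n) = pCons 0 (pCons 0 (flat_poly n - pderiv (flat_poly n)))"

text \<open>\<open>flat_deriv n\<close> is the \<open>n\<close>-th derivative of the flat function \<open>s \<mapsto> exp (-1/s)\<close>
  (extended by \<open>0\<close> for \<open>s \<le> 0\<close>): differentiating \<open>P (1/s) exp (-1/s)\<close> gives
  \<open>(P - P') (1/s) / s\<^sup>2 exp (-1/s)\<close>, whence the recursion for \<open>flat_poly\<close>.\<close>
definition flat_deriv :: "nat \<Rightarrow> real \<Rightarrow> real" where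
  "flat_deriv n s = (if 0 < s then poly (flat_poly n) (inverse s) * exp (- inverse s) else 0)"

lemma poly_times_exp_minus_tendsto_0:
  fixes P :: "real poly"
  shows "((\<lambda>y. poly P y * exp (- y)) \<longlongrightarrow> 0) at_top"
proof -
  have "((\<lambda>y. \<Sum>i\<le>degree P. coeff P i * (y ^ i / exp y)) \<longlongrightarrow> (\<Sum>i\<le>degree P. coeff P i * 0)) at_top"
    by (intro tendsto_sum tendsto_mult tendsto_const tendsto_power_div_exp_0)
  moreover have "(\<Sum>i\<le>degree P. coeff P i * (y ^ i / exp y)) = poly P y * exp (- y)" for y
    by (simp add: poly_altdef sum_distrib_right exp_minus divide_inverse mult.assoc)
  ultimately show ?thesis by simp
qed

lemma flat_deriv_has_derivative: "(flat_deriv n has_real_derivative flat_deriv (Suc n) x) (at x)"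
proof -
  consider "x > 0" | "x < 0" | "x = 0" by linarith
  then show ?thesis
  proof cases
    case 1
    let ?P = "flat_poly n"
    have "((\<lambda>s. poly ?P (inverse s) * exp (- inverse s)) has_real_derivative
       poly (pderiv ?P) (inverse x) * (- (inverse x ^ 2)) * exp (- inverse x)
       + poly ?P (inverse x) * (exp (- inverse x) * (inverse x ^ 2))) (at x)"
      using 1 by (auto intro!: derivative_eq_intros DERIV_chain2[OF poly_DERIV] simp: power2_eq_square)
    also have "poly (pderiv ?P) (inverse x) * (- (inverse x ^ 2)) * exp (- inverse x)
       + poly ?P (inverse x) * (exp (- inverse x) * (inverse x ^ 2)) = flat_deriv (Suc n) x"
      using 1 by (simp add: flat_deriv_def algebra_simps power2_eq_square)
    finally show ?thesis
      by (rule has_field_derivative_transform_within_open[where S="{0<..}"])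
        (use 1 in \<open>auto simp: flat_deriv_def\<close>)
  next
    case 2
    have "((\<lambda>s. 0) has_real_derivative flat_deriv (Suc n) x) (at x)"
      using 2 by (simp add: flat_deriv_def)
    then show ?thesis
      by (rule has_field_derivative_transform_within_open[where S="{..<0}"])
        (use 2 in \<open>auto simp: flat_deriv_def\<close>)
  next
    case 3
    let ?q = "\<lambda>y. (flat_deriv n y - flat_deriv n 0) / (y - 0)"
    \<comment> \<open>for \<open>y > 0\<close> the difference quotient is \<open>(X P)(1/y) exp (-1/y)\<close> with \<open>P = flat_poly n\<close>\<close>
    have "((\<lambda>s. poly (pCons 0 (flat_poly n)) (inverse s) * exp (- inverse s)) \<longlongrightarrow> 0) (at_right 0)"
      by (rule filterlim_compose[OF poly_times_exp_minus_tendsto_0 filterlim_inverse_at_top_right])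
    then have right: "(?q \<longlongrightarrow> 0) (at_right 0)"
      by (rule Lim_transform_eventually)
        (use eventually_at_right_less[of "0::real"] in \<open>eventually_elim, simp add: flat_deriv_def field_simps\<close>)
    have "\<forall>\<^sub>F y in at_left 0. y \<in> {-1<..<(0::real)}"
      by (rule eventually_at_left_real) simp
    then have "\<forall>\<^sub>F y in at_left 0. 0 = ?q y"
      by eventually_elim (simp add: flat_deriv_def)
    then have left: "(?q \<longlongrightarrow> 0) (at_left 0)"
      by (rule Lim_transform_eventually[OF tendsto_const])
    have "(?q \<longlongrightarrow> 0) (at 0)"
      using filterlim_split_at[OF left right] .
    then have "(flat_deriv n has_real_derivative 0) (at 0)"
      by (simp add: has_field_derivative_iff)
    then show ?thesis using 3 by (simp add: flat_deriv_def)
  qed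
qed

definition bump :: "'a::euclidean_space \<Rightarrow> real \<Rightarrow> 'a \<Rightarrow> real" where
  "bump c r x = flat_deriv 0 (r\<^sup>2 - (x - c) \<bullet> (x - c))"

lemma Cinf_bump: "Cinf (bump c r)"
proof -
  have "Ck k (\<lambda>x. r\<^sup>2 - (x - c) \<bullet> (x - c))" for k
  proof (cases k)
    case (Suc m)
    have "Ck m (\<lambda>x. -2 * ((x - c) \<bullet> i))" for i
      using Ck_affine[of m "2 * (c \<bullet> i)" "-2 *\<^sub>R i"] by (simp add: algebra_simps inner_diff_left)
    then have "Ck (Suc m) (\<lambda>x. r\<^sup>2 - (x - c) \<bullet> (x - c))"
      by (intro Ck_SucI[where f'="\<lambda>x h. -2 * ((x - c) \<bullet> h)"])
        (auto intro!: derivative_eq_intros simp: inner_commute algebra_simps)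
    then show ?thesis using Suc by simp
  qed (simp add: continuous_intros)
  then show ?thesis
    unfolding Cinf_def bump_def[abs_def]
    using Ck_compose_derivative_tower flat_deriv_has_derivative derivative_tower_def by blast
qed

lemma bump_center_pos: "0 < r \<Longrightarrow> 0 < bump c r c"
  by (simp add: bump_def flat_deriv_def)

lemma bump_nonzero_imp_mem_ball:
  assumes "0 \<le> r" and "bump c r x \<noteq> 0"
  shows "x \<in> ball c r"
proof -
  have "norm (x - c) ^ 2 < r\<^sup>2"
    using assms(2) by (auto simp: bump_def flat_deriv_def power2_norm_eq_inner split: if_splits)
  then show ?thesis
    using assms(1) by (simp add: power_less_imp_less_base dist_norm norm_minus_commute)
qed

lemma test_fun_bump:
  assumes "0 \<le> r" and "cball c r \<subseteq> \<Omega>"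
  shows "test_fun \<Omega> (bump c r)"
proof -
  have "{x. bump c r x \<noteq> 0} \<subseteq> ball c r"
    using bump_nonzero_imp_mem_ball[OF assms(1)] by blast
  then have "closure {x. bump c r x \<noteq> 0} \<subseteq> cball c r"
    by (meson ball_subset_cball closed_cball closure_minimal order_trans)
  then show ?thesis
    unfolding test_fun_def using Cinf_bump assms(2) compact_closure
    by (metis bounded_cball bounded_subset closure_subset order_trans)
qed

section \<open>Change of variables and integration by parts\<close>

lemma lebesgue_affine:
  fixes t :: "'a::euclidean_space"
  assumes "c \<noteq> 0"
  shows "lebesgue = density (distr lebesgue lebesgue (\<lambda>x. t + c *\<^sub>R x)) (\<lambda>_. \<bar>c\<bar> ^ DIM('a))"
    and "(\<lambda>x. t + c *\<^sub>R x) \<in> lebesgue \<rightarrow>\<^sub>M lebesgue"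
proof -
  have eq: "(\<lambda>x. t + (\<Sum>j\<in>Basis. (c * (x \<bullet> j)) *\<^sub>R j)) = (\<lambda>x::'a. t + c *\<^sub>R x)"
    unfolding scaleR_scaleR[symmetric] scaleR_sum_right[symmetric] euclidean_representation by simp
  show "lebesgue = density (distr lebesgue lebesgue (\<lambda>x. t + c *\<^sub>R x)) (\<lambda>_. \<bar>c\<bar> ^ DIM('a))"
    using lebesgue_affine_euclidean[of "\<lambda>_. c" t] assms unfolding eq by (simp add: prod_constant)
  show "(\<lambda>x. t + c *\<^sub>R x) \<in> lebesgue \<rightarrow>\<^sub>M lebesgue"
    using lebesgue_affine_measurable[of "\<lambda>_. c" t] assms unfolding eq by simp
qed

lemma nn_integral_lebesgue_affine:
  fixes t :: "'a::euclidean_space"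
  assumes f[measurable]: "f \<in> borel_measurable lebesgue" and c: "c \<noteq> 0"
  shows "(\<integral>\<^sup>+x. f x \<partial>lebesgue) = ennreal (\<bar>c\<bar> ^ DIM('a)) * (\<integral>\<^sup>+x. f (t + c *\<^sub>R x) \<partial>lebesgue)"
proof -
  let ?T = "\<lambda>x. t + c *\<^sub>R x"
  note T = lebesgue_affine(2)[OF c, of t]
  have "(\<integral>\<^sup>+x. f x \<partial>lebesgue) = (\<integral>\<^sup>+x. f x \<partial>density (distr lebesgue lebesgue ?T) (\<lambda>_. \<bar>c\<bar> ^ DIM('a)))"
    using lebesgue_affine(1)[OF c, of t] by auto
  also have "\<dots> = \<integral>\<^sup>+ x. ennreal (\<bar>c\<bar> ^ DIM('a)) * f x \<partial>distr lebesgue lebesgue ?T"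
    by (subst nn_integral_density) auto
  also have "\<dots> = ennreal (\<bar>c\<bar> ^ DIM('a)) * integral\<^sup>N (distr lebesgue lebesgue ?T) f"
    using f measurable_distr_eq1 nn_integral_cmult by blast
  also have "\<dots> = ennreal (\<bar>c\<bar> ^ DIM('a)) * (\<integral>\<^sup>+x. f (t + c *\<^sub>R x) \<partial>lebesgue)"
    using T by (subst nn_integral_distr) force+
  finally show ?thesis .
qed

lemma integrable_lebesgue_affine:
  fixes f :: "'a::euclidean_space \<Rightarrow> real"
  assumes f: "integrable lebesgue f" and c: "c \<noteq> 0"
  shows "integrable lebesgue (\<lambda>x. f (t + c *\<^sub>R x))"
proof -
  have "(\<lambda>x. norm (f x)) \<in> borel_measurable lebesgue"
    by (simp add: borel_measurable_integrable f)
  moreover have "(\<lambda>x. f (t + c *\<^sub>R x)) \<in> borel_measurable lebesgue"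
    using borel_measurable_affine[of f c t] f c by (simp add: borel_measurable_integrable)
  ultimately show ?thesis
    using f c unfolding integrable_iff_bounded
    by (subst (asm) nn_integral_lebesgue_affine[where c=c and t=t]) (auto simp: ennreal_mult_less_top)
qed

lemma integrable_lebesgue_affine_iff:
  fixes f :: "'a::euclidean_space \<Rightarrow> real"
  assumes c: "c \<noteq> 0"
  shows "integrable lebesgue (\<lambda>x. f (t + c *\<^sub>R x)) \<longleftrightarrow> integrable lebesgue f"
proof
  assume "integrable lebesgue (\<lambda>x. f (t + c *\<^sub>R x))"
  from integrable_lebesgue_affine[OF this, of "1/c" "- t /\<^sub>R c"] c show "integrable lebesgue f"
    by (simp add: algebra_simps)
qed (rule integrable_lebesgue_affine[OF _ c])

lemma integral_lebesgue_affine: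
  fixes f :: "'a::euclidean_space \<Rightarrow> real"
  assumes c: "c \<noteq> 0"
  shows "(\<integral>x. f x \<partial>lebesgue) = \<bar>c\<bar> ^ DIM('a) * (\<integral>x. f (t + c *\<^sub>R x) \<partial>lebesgue)"
proof cases
  assume "integrable lebesgue f"
  with lebesgue_affine(2)[OF c, of t] show ?thesis
    by (subst lebesgue_affine(1)[OF c, of t]) (auto simp: integral_density integral_distr)
next
  assume "\<not> integrable lebesgue f"
  with c show ?thesis
    by (simp add: integrable_lebesgue_affine_iff not_integrable_integral_eq)
qed

lemma
  assumes "\<And>x. x \<notin> A \<Longrightarrow> f x = 0"
  shows set_integrable_iff_integrable_vanishing: "set_integrable M A f \<longleftrightarrow> integrable M f"
    and set_integral_eq_integral_vanishing: "(LINT x:A|M. f x) = integral\<^sup>L M f"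
proof -
  have "(\<lambda>x. indicator A x *\<^sub>R f x) = f"
    using assms by (auto simp: indicator_def fun_eq_iff)
  then show "set_integrable M A f \<longleftrightarrow> integrable M f" "(LINT x:A|M. f x) = integral\<^sup>L M f"
    by (simp_all add: set_integrable_def set_lebesgue_integral_def)
qed

lemma continuous_imp_borel_measurable_lebesgue:
  "continuous_on UNIV f \<Longrightarrow> f \<in> borel_measurable lebesgue"
  using continuous_imp_measurable_on_sets_lebesgue[of UNIV f] by (simp add: lebesgue_on_UNIV_eq)

lemma integrable_continuous_bounded_support:
  fixes f :: "'a::euclidean_space \<Rightarrow> real"
  assumes f: "continuous_on UNIV f" and B: "bounded B" and z: "\<And>x. x \<notin> B \<Longrightarrow> f x = 0"
  shows "integrable lebesgue f"
proof -
  obtain a where a: "B \<subseteq> cbox (-a) a"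
    using bounded_subset_cbox_symmetric[OF B] by blast
  have "set_integrable lebesgue (cbox (-a) a) f"
    using absolutely_integrable_continuous[OF continuous_on_subset[OF f]] by blast
  then show ?thesis
    using a z by (subst (asm) set_integrable_iff_integrable_vanishing) auto
qed

lemma set_integrable_continuous_bounded:
  fixes f :: "'a::euclidean_space \<Rightarrow> real"
  assumes "continuous_on UNIV f" and "bounded \<Omega>" and "\<Omega> \<in> sets lebesgue"
  shows "set_integrable lebesgue \<Omega> f"
proof -
  obtain a where "\<Omega> \<subseteq> cbox (-a) a"
    using bounded_subset_cbox_symmetric[OF assms(2)] by blast
  then show ?thesis
    using absolutely_integrable_continuous[OF continuous_on_subset[OF assms(1)]] assms(3)
    by (blast intro: set_integrable_subset)
qed

lemma has_real_derivative_along_line: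
  assumes "(h has_derivative h') (at (x + t *\<^sub>R i))"
  shows "((\<lambda>t. h (x + t *\<^sub>R i)) has_real_derivative h' i) (at t)"
proof -
  have "((\<lambda>t. x + t *\<^sub>R i) has_derivative (\<lambda>t. t *\<^sub>R i)) (at t)"
    by (auto intro!: derivative_eq_intros)
  from has_derivative_compose[OF this assms]
  have "((\<lambda>t. h (x + t *\<^sub>R i)) has_derivative (\<lambda>u. h' (u *\<^sub>R i))) (at t)" .
  moreover have "(\<lambda>u. h' (u *\<^sub>R i)) = (\<lambda>u. h' i * u)"
    using linear_cmul[OF has_derivative_linear[OF assms]] by (auto simp: fun_eq_iff)
  ultimately show ?thesis by (simp add: has_field_derivative_def)
qed

lemma difference_quotient_bound:
  assumes h: "\<And>y. (h has_derivative h' y) (at y)"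
    and M: "\<And>t. 0 \<le> t \<Longrightarrow> t \<le> e \<Longrightarrow> \<bar>h' (x + t *\<^sub>R i) i\<bar> \<le> M" and e: "0 < e"
  shows "\<bar>(h (x + e *\<^sub>R i) - h x) / e\<bar> \<le> M"
proof -
  obtain z where z: "0 < z" "z < e" and eq: "h (x + e *\<^sub>R i) - h (x + 0 *\<^sub>R i) = (e - 0) * h' (x + z *\<^sub>R i) i"
    using MVT2[OF e has_real_derivative_along_line[OF h]] by blast
  then show ?thesis using M[of z] e by (simp add: abs_mult)
qed

lemma tendsto_difference_quotient:
  assumes "(h has_derivative h') (at x)" and "filterlim e (at_right 0) sequentially"
  shows "(\<lambda>n. (h (x + e n *\<^sub>R i) - h x) / e n) \<longlonglongrightarrow> h' i"
proof -
  have "((\<lambda>t. h (x + t *\<^sub>R i)) has_real_derivative h' i) (at 0)"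
    using has_real_derivative_along_line[of h h' x 0 i] assms(1) by simp
  then have "((\<lambda>t. (h (x + t *\<^sub>R i) - h x) / t) \<longlongrightarrow> h' i) (at_right 0)"
    by (simp add: has_field_derivative_iff filterlim_at_split)
  with assms(2) show ?thesis
    by (auto dest: filterlim_compose simp: o_def)
qed

lemma difference_quotient_le_indicator:
  fixes h :: "'a::euclidean_space \<Rightarrow> real"
  assumes h: "\<And>y. (h has_derivative h' y) (at y)"
    and B: "\<And>x. x \<in> B \<Longrightarrow> norm x \<le> R" and z: "\<And>x. x \<notin> B \<Longrightarrow> h x = 0"
    and M: "\<And>y. y \<in> cball 0 (R + 2) \<Longrightarrow> \<bar>h' y i\<bar> \<le> M"
    and i: "norm i = 1" and e: "0 < e" "e \<le> 1"
  shows "\<bar>(h (x + e *\<^sub>R i) - h x) / e\<bar> \<le> M * indicator (cball 0 (R + 1)) x"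
proof (cases "x \<in> cball 0 (R + 1)")
  case True
  have "\<bar>h' (x + t *\<^sub>R i) i\<bar> \<le> M" if "0 \<le> t" "t \<le> e" for t
  proof (rule M)
    have "norm (x + t *\<^sub>R i) \<le> norm x + \<bar>t\<bar>"
      using norm_triangle_ineq[of x "t *\<^sub>R i"] i by simp
    then show "x + t *\<^sub>R i \<in> cball 0 (R + 2)"
      using True that e by simp
  qed
  then show ?thesis
    using difference_quotient_bound[OF h _ e(1)] True by simp
next
  case False
  then have "norm x > R + 1"
    by simp
  then have "x \<notin> B" "x + e *\<^sub>R i \<notin> B"
    using B norm_triangle_ineq4[of "x + e *\<^sub>R i" "e *\<^sub>R i"] e i by force+
  then show ?thesis
    using False by (simp add: z)
qed

lemma integral_partial_derivative_eq_0:
  fixes h :: "'a::euclidean_space \<Rightarrow> real"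
  assumes h: "Ck 1 h" and B: "bounded B" and z: "\<And>x. x \<notin> B \<Longrightarrow> h x = 0" and i: "i \<in> Basis"
  shows "integral\<^sup>L lebesgue (\<lambda>x. frechet_derivative h (at x) i) = 0"
proof -
  define d where "d x = frechet_derivative h (at x) i" for x
  have hd: "(h has_derivative frechet_derivative h (at x)) (at x)" for x
    using Ck_SucD(1)[of 0 h] h by simp
  have dc: "continuous_on UNIV d"
    using Ck_SucD(2)[of 0 h i] h i unfolding d_def by simp
  have hc: "continuous_on UNIV h"
    using Ck_imp_continuous_on[OF h] .
  obtain R where R: "\<And>x. x \<in> B \<Longrightarrow> norm x \<le> R"
    using B unfolding bounded_pos by blast
  obtain M where M: "\<And>y. y \<in> cball 0 (R + 2) \<Longrightarrow> \<bar>d y\<bar> \<le> M"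
    using compact_imp_bounded[OF compact_continuous_image[OF continuous_on_subset[OF dc]]]
    unfolding bounded_iff by (metis compact_cball image_eqI real_norm_def subset_UNIV)
  text \<open>Dominated convergence for the difference quotients, whose integrals vanish by translation
    invariance.\<close>
  define e :: "nat \<Rightarrow> real" where "e n = inverse (real (Suc n))" for n
  have e: "0 < e n" "e n \<le> 1" for n
    by (auto simp: e_def field_simps)
  have e_lim: "filterlim e (at_right 0) sequentially"
    by (rule tendsto_imp_filterlim_at_right) (use LIMSEQ_inverse_real_of_nat in \<open>auto simp: e_def[abs_def]\<close>)
  define s where "s n x = (h (x + e n *\<^sub>R i) - h x) / e n" for n x
  define w where "w x = M * indicator (cball (0::'a) (R + 1)) x" for x
  have hint: "integrable lebesgue h"
    by (rule integrable_continuous_bounded_support[OF hc B z])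
  have s_int: "integral\<^sup>L lebesgue (s n) = 0" for n
    using integral_lebesgue_affine[of 1 h "e n *\<^sub>R i"] integrable_lebesgue_affine[OF hint, of 1 "e n *\<^sub>R i"] hint
    unfolding s_def[abs_def] by (simp add: add.commute)
  have s_meas: "s n \<in> borel_measurable lebesgue" for n
    unfolding s_def
    by (intro borel_measurable_divide borel_measurable_diff continuous_imp_borel_measurable_lebesgue
        continuous_on_compose2[OF hc]) (auto intro!: continuous_intros)
  have w_int: "integrable lebesgue w"
    unfolding w_def using lmeasurable_cball[of "0::'a" "R + 1"]
    by (intro integrable_mult_right integrable_real_indicator) (auto simp: fmeasurable_def)
  have "AE x in lebesgue. (\<lambda>n. s n x) \<longlonglongrightarrow> d x"
    using tendsto_difference_quotient[OF hd e_lim] unfolding s_def d_def by simp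
  moreover have "AE x in lebesgue. norm (s n x) \<le> w x" for n
    using difference_quotient_le_indicator[OF hd R z M[unfolded d_def] _ e] i
    unfolding s_def w_def by simp
  ultimately have "(\<lambda>n. integral\<^sup>L lebesgue (s n)) \<longlonglongrightarrow> integral\<^sup>L lebesgue d"
    by (intro integral_dominated_convergence[OF continuous_imp_borel_measurable_lebesgue[OF dc] s_meas w_int])
  then show ?thesis
    using s_int unfolding d_def by (simp add: LIMSEQ_const_iff)
qed

section \<open>Test functions\<close>

lemma inner_grad_Basis: "i \<in> Basis \<Longrightarrow> grad f x \<bullet> i = frechet_derivative f (at x) i"
  by (simp add: grad_def inner_sum_left inner_Basis if_distrib sum.delta cong: if_cong)

lemma continuous_on_grad: "Ck (Suc k) f \<Longrightarrow> continuous_on UNIV (grad f)"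
  unfolding grad_def[abs_def]
  by (intro continuous_on_sum continuous_on_scaleR continuous_on_const Ck_imp_continuous_on[OF Ck_SucD(2)]) auto

lemma test_fun_eq_0:
  assumes "test_fun \<Omega> \<phi>" and "x \<notin> \<Omega>"
  shows "\<phi> x = 0"
proof (rule ccontr)
  assume "\<phi> x \<noteq> 0"
  then have "x \<in> closure {x. \<phi> x \<noteq> 0}"
    using closure_subset[of "{x. \<phi> x \<noteq> 0}"] by auto
  then show False
    using assms unfolding test_fun_def by auto
qed

lemma test_fun_bounded_support:
  assumes "test_fun \<Omega> \<phi>"
  obtains B where "bounded B" and "\<And>x. x \<notin> B \<Longrightarrow> \<phi> x = 0"
proof
  show "bounded (closure {x. \<phi> x \<noteq> 0})"
    using assms by (simp add: test_fun_def compact_imp_bounded)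
  show "\<phi> x = 0" if "x \<notin> closure {x. \<phi> x \<noteq> 0}" for x
    using that closure_subset[of "{x. \<phi> x \<noteq> 0}"] by auto
qed

lemma test_fun_has_derivative:
  "test_fun \<Omega> \<phi> \<Longrightarrow> (\<phi> has_derivative frechet_derivative \<phi> (at x)) (at x)"
  using Ck_SucD(1)[of 0 \<phi>] by (simp add: test_fun_def Cinf_def)

lemma weak_grad_test_fun:
  fixes \<phi> :: "'a::euclidean_space \<Rightarrow> real"
  assumes \<phi>: "test_fun \<Omega> \<phi>"
  shows "weak_grad \<Omega> \<phi> (grad \<phi>)"
  unfolding weak_grad_def
proof (intro allI impI ballI conjI)
  fix \<psi> :: "'a \<Rightarrow> real" and i :: 'a
  assume \<psi>: "test_fun \<Omega> \<psi>" and i: "i \<in> Basis"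
  obtain B\<phi> where B\<phi>: "bounded B\<phi>" "\<And>x. x \<notin> B\<phi> \<Longrightarrow> \<phi> x = 0"
    using test_fun_bounded_support[OF \<phi>] by blast
  obtain B\<psi> where B\<psi>: "bounded B\<psi>" "\<And>x. x \<notin> B\<psi> \<Longrightarrow> \<psi> x = 0"
    using test_fun_bounded_support[OF \<psi>] by blast
  have C\<phi>: "Ck k \<phi>" and C\<psi>: "Ck k \<psi>" for k
    using \<phi> \<psi> by (simp_all add: test_fun_def Cinf_imp_Ck)
  let ?\<phi>\<psi>' = "\<lambda>x. \<phi> x * frechet_derivative \<psi> (at x) i"
  let ?\<phi>'\<psi> = "\<lambda>x. frechet_derivative \<phi> (at x) i * \<psi> x"
  have vanish: "x \<notin> \<Omega> \<Longrightarrow> ?\<phi>\<psi>' x = 0" "x \<notin> \<Omega> \<Longrightarrow> ?\<phi>'\<psi> x = 0" for x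
    using test_fun_eq_0[OF \<phi>] test_fun_eq_0[OF \<psi>] by auto
  have cont: "continuous_on UNIV ?\<phi>\<psi>'" "continuous_on UNIV ?\<phi>'\<psi>"
    using Ck_imp_continuous_on[OF Ck_SucD(2)[OF C\<phi> i]] Ck_imp_continuous_on[OF Ck_SucD(2)[OF C\<psi> i]]
      Ck_imp_continuous_on[OF C\<phi>] Ck_imp_continuous_on[OF C\<psi>]
    by (auto intro!: continuous_intros)
  have int: "integrable lebesgue ?\<phi>\<psi>'" "integrable lebesgue ?\<phi>'\<psi>"
    using integrable_continuous_bounded_support[OF cont(1) B\<phi>(1)]
      integrable_continuous_bounded_support[OF cont(2) B\<psi>(1)] B\<phi>(2) B\<psi>(2) by auto
  have D: "((\<lambda>x. \<phi> x * \<psi> x) has_derivative (\<lambda>v. \<phi> x * frechet_derivative \<psi> (at x) v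
      + frechet_derivative \<phi> (at x) v * \<psi> x)) (at x)" for x
    using Ck_SucD(1)[OF C\<phi>] Ck_SucD(1)[OF C\<psi>] by (auto intro!: derivative_eq_intros)
  have "frechet_derivative (\<lambda>x. \<phi> x * \<psi> x) (at x) i = ?\<phi>\<psi>' x + ?\<phi>'\<psi> x" for x
    by (simp add: frechet_derivative_at[OF D, symmetric])
  moreover have "integral\<^sup>L lebesgue (\<lambda>x. frechet_derivative (\<lambda>x. \<phi> x * \<psi> x) (at x) i) = 0"
    by (rule integral_partial_derivative_eq_0[OF Ck_mult[OF C\<phi> C\<psi>] B\<phi>(1) _ i]) (simp add: B\<phi>(2))
  ultimately have "integral\<^sup>L lebesgue ?\<phi>\<psi>' = - integral\<^sup>L lebesgue ?\<phi>'\<psi>"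
    using int by simp
  then show "set_integrable lebesgue \<Omega> ?\<phi>\<psi>'"
    and "set_integrable lebesgue \<Omega> (\<lambda>x. (grad \<phi> x \<bullet> i) * \<psi> x)"
    and "(LINT x:\<Omega>|lebesgue. ?\<phi>\<psi>' x) = - (LINT x:\<Omega>|lebesgue. (grad \<phi> x \<bullet> i) * \<psi> x)"
    unfolding inner_grad_Basis[OF i]
    by (simp_all add: int set_integrable_iff_integrable_vanishing set_integral_eq_integral_vanishing vanish)
qed

lemma W01p_test_fun:
  fixes \<phi> :: "'a::euclidean_space \<Rightarrow> real"
  assumes \<phi>: "test_fun \<Omega> \<phi>" and \<Omega>: "bounded \<Omega>" "\<Omega> \<in> sets lebesgue" and p: "0 < p"
  shows "W01p \<Omega> p \<phi> (grad \<phi>)"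
  unfolding W01p_def W1p_def Lp_def
proof (intro conjI)
  have C: "Ck k \<phi>" for k
    using \<phi> by (simp add: test_fun_def Cinf_imp_Ck)
  have cont: "continuous_on UNIV \<phi>" "continuous_on UNIV (grad \<phi>)"
    using Ck_imp_continuous_on[OF C] continuous_on_grad[OF C] by blast+
  show "set_borel_measurable lebesgue \<Omega> \<phi>" "set_borel_measurable lebesgue \<Omega> (grad \<phi>)"
    unfolding set_borel_measurable_def
    by (intro borel_measurable_scaleR borel_measurable_indicator \<Omega>(2)
        continuous_imp_borel_measurable_lebesgue cont)+
  show "set_integrable lebesgue \<Omega> (\<lambda>x. norm (\<phi> x) powr p)"
    using p by (intro set_integrable_continuous_bounded[OF _ \<Omega>] continuous_on_powr'
        continuous_on_norm cont(1) continuous_on_const) auto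
  show "set_integrable lebesgue \<Omega> (\<lambda>x. norm (grad \<phi> x) powr p)"
    using p by (intro set_integrable_continuous_bounded[OF _ \<Omega>] continuous_on_powr'
        continuous_on_norm cont(2) continuous_on_const) auto
  show "weak_grad \<Omega> \<phi> (grad \<phi>)"
    by (rule weak_grad_test_fun[OF \<phi>])
  show "\<exists>\<phi>'::nat \<Rightarrow> 'a \<Rightarrow> real. (\<forall>n. test_fun \<Omega> (\<phi>' n)) \<and>
        ((\<lambda>n. (LINT x:\<Omega>|lebesgue. \<bar>\<phi>' n x - \<phi> x\<bar> powr p)
             + (LINT x:\<Omega>|lebesgue. norm (grad (\<phi>' n) x - grad \<phi> x) powr p)) \<longlonglongrightarrow> 0)"
    by (rule exI[of _ "\<lambda>n. \<phi>"]) (simp add: \<phi>)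
qed

lemma set_integral_pos_continuous:
  fixes f :: "'a::euclidean_space \<Rightarrow> real"
  assumes f: "continuous_on UNIV f" "\<And>x. 0 \<le> f x" and "open \<Omega>" "c \<in> \<Omega>" "0 < f c"
    and int: "set_integrable lebesgue \<Omega> f"
  shows "0 < (LINT x:\<Omega>|lebesgue. f x)"
proof (rule ccontr)
  define U where "U = \<Omega> \<inter> {x. 0 < f x}"
  have U: "open U" "c \<in> U"
    using assms open_Collect_less[OF continuous_on_const f(1), of 0] by (auto simp: U_def)
  assume "\<not> 0 < (LINT x:\<Omega>|lebesgue. f x)"
  moreover have "0 \<le> (LINT x:\<Omega>|lebesgue. f x)"
    unfolding set_lebesgue_integral_def using f(2) by (intro Bochner_Integration.integral_nonneg) simp
  ultimately have "integral\<^sup>L lebesgue (\<lambda>x. indicator \<Omega> x *\<^sub>R f x) = 0"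
    by (simp add: set_lebesgue_integral_def)
  then have "AE x in lebesgue. indicator \<Omega> x *\<^sub>R f x = 0"
    using int f(2) unfolding set_integrable_def by (subst (asm) integral_nonneg_eq_0_iff_AE) auto
  then have "AE x in lebesgue. x \<notin> U"
    by eventually_elim (auto simp: U_def)
  then have "U \<in> null_sets lebesgue"
    using U(1) by (simp add: AE_iff_null_sets borel_open)
  then have "negligible U"
    by (simp add: negligible_iff_null_sets)
  then show False
    using open_not_negligible[OF U(1)] U(2) by auto
qed

section \<open>Dilations\<close>

lemma mem_scaleR_image_iff:
  fixes A :: "'a::real_vector set"
  shows "s \<noteq> 0 \<Longrightarrow> x \<in> (*\<^sub>R) s ` A \<longleftrightarrow> x /\<^sub>R s \<in> A"
  by (auto simp: image_iff intro: bexI[of _ "x /\<^sub>R s"])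

lemma scaleR_image_scaleR_image_inverse:
  fixes A :: "'a::real_vector set"
  shows "s \<noteq> 0 \<Longrightarrow> (*\<^sub>R) (inverse s) ` (*\<^sub>R) s ` A = A"
  by (simp add: image_comp o_def)

lemma cube_eq_scaleR_image: "0 < t \<Longrightarrow> cube t = (*\<^sub>R) t ` cube 1"
  by (auto simp: mem_scaleR_image_iff cube_def mem_box inner_Basis field_simps)

lemma
  fixes f :: "'a::euclidean_space \<Rightarrow> real"
  assumes s: "0 < s"
  shows set_integrable_dilate_iff:
      "set_integrable lebesgue ((*\<^sub>R) s ` \<Omega>) f \<longleftrightarrow> set_integrable lebesgue \<Omega> (\<lambda>y. f (s *\<^sub>R y))"
    and set_integral_dilate:
      "(LINT x:(*\<^sub>R) s ` \<Omega>|lebesgue. f x) = s ^ DIM('a) * (LINT y:\<Omega>|lebesgue. f (s *\<^sub>R y))"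
proof -
  define g where "g x = indicator ((*\<^sub>R) s ` \<Omega>) x *\<^sub>R f x" for x
  have g: "(\<lambda>y. g (0 + s *\<^sub>R y)) = (\<lambda>y. indicator \<Omega> y *\<^sub>R f (s *\<^sub>R y))"
    using s by (auto simp: g_def indicator_def fun_eq_iff mem_scaleR_image_iff)
  show "set_integrable lebesgue ((*\<^sub>R) s ` \<Omega>) f \<longleftrightarrow> set_integrable lebesgue \<Omega> (\<lambda>y. f (s *\<^sub>R y))"
    using integrable_lebesgue_affine_iff[of s g 0] s
    unfolding set_integrable_def g g_def[symmetric] by simp
  show "(LINT x:(*\<^sub>R) s ` \<Omega>|lebesgue. f x) = s ^ DIM('a) * (LINT y:\<Omega>|lebesgue. f (s *\<^sub>R y))"
    using integral_lebesgue_affine[of s g 0] s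
    unfolding set_lebesgue_integral_def g g_def[symmetric] by simp
qed

lemma set_borel_measurable_dilate:
  fixes F :: "'a::euclidean_space \<Rightarrow> 'b::euclidean_space"
  assumes s: "0 < s" and F: "set_borel_measurable lebesgue \<Omega> F"
  shows "set_borel_measurable lebesgue ((*\<^sub>R) s ` \<Omega>) (\<lambda>x. c *\<^sub>R F (x /\<^sub>R s))"
proof -
  define h where "h x = indicator \<Omega> x *\<^sub>R F x" for x
  have "(\<lambda>x. h (0 + inverse s *\<^sub>R x)) \<in> borel_measurable lebesgue"
    using borel_measurable_affine[of h "inverse s" 0] F s
    unfolding set_borel_measurable_def h_def[abs_def] by simp
  moreover have "(\<lambda>x. h (0 + inverse s *\<^sub>R x)) = (\<lambda>x. indicator ((*\<^sub>R) s ` \<Omega>) x *\<^sub>R F (x /\<^sub>R s))"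
    using s by (auto simp: h_def indicator_def fun_eq_iff mem_scaleR_image_iff)
  ultimately have "(\<lambda>x. indicator ((*\<^sub>R) s ` \<Omega>) x *\<^sub>R F (x /\<^sub>R s)) \<in> borel_measurable lebesgue"
    by metis
  then have "(\<lambda>x. c *\<^sub>R (indicator ((*\<^sub>R) s ` \<Omega>) x *\<^sub>R F (x /\<^sub>R s))) \<in> borel_measurable lebesgue"
    by (rule borel_measurable_scaleR[OF borel_measurable_const])
  then show ?thesis
    unfolding set_borel_measurable_def by (simp add: scaleR_left_commute mult.commute)
qed

lemma Lp_dilate:
  fixes f :: "'a::euclidean_space \<Rightarrow> 'b::euclidean_space"
  assumes s: "0 < s" and f: "Lp \<Omega> p f"
  shows "Lp ((*\<^sub>R) s ` \<Omega>) p (\<lambda>x. c *\<^sub>R f (x /\<^sub>R s))"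
  using f set_borel_measurable_dilate[OF s, of \<Omega> f c] s
  unfolding Lp_def set_integrable_dilate_iff[OF s]
  by (simp add: powr_mult)

lemma test_fun_dilate:
  fixes \<phi> :: "'a::euclidean_space \<Rightarrow> real"
  assumes \<phi>: "test_fun \<Omega> \<phi>" and b: "b \<noteq> 0" and s: "0 < s"
  shows "test_fun ((*\<^sub>R) s ` \<Omega>) (\<lambda>x. b * \<phi> (x /\<^sub>R s))"
  unfolding test_fun_def
proof (intro conjI)
  show "Cinf (\<lambda>x. b * \<phi> (x /\<^sub>R s))"
    using \<phi> unfolding Cinf_def test_fun_def by (auto intro: Ck_scale_comp)
  have "{x. b * \<phi> (x /\<^sub>R s) \<noteq> 0} = (*\<^sub>R) s ` {x. \<phi> x \<noteq> 0}"
    using b s by (auto simp: mem_scaleR_image_iff)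
  then have supp: "closure {x. b * \<phi> (x /\<^sub>R s) \<noteq> 0} = (*\<^sub>R) s ` closure {x. \<phi> x \<noteq> 0}"
    using s by (simp add: closure_injective_linear_image linear_scaleR inj_on_def)
  show "compact (closure {x. b * \<phi> (x /\<^sub>R s) \<noteq> 0})"
    unfolding supp using \<phi> by (simp add: compact_scaling test_fun_def)
  show "closure {x. b * \<phi> (x /\<^sub>R s) \<noteq> 0} \<subseteq> (*\<^sub>R) s ` \<Omega>"
    unfolding supp using \<phi> by (auto simp: test_fun_def)
qed

lemma frechet_derivative_dilate:
  assumes "(\<phi> has_derivative frechet_derivative \<phi> (at (x /\<^sub>R s))) (at (x /\<^sub>R s))"
  shows "frechet_derivative (\<lambda>x. b * \<phi> (x /\<^sub>R s)) (at x) = (\<lambda>h. (b / s) * frechet_derivative \<phi> (at (x /\<^sub>R s)) h)"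
  using frechet_derivative_at[OF has_derivative_scale_comp[OF assms, of b]] by (simp add: divide_inverse)

lemma grad_dilate:
  assumes "(\<phi> has_derivative frechet_derivative \<phi> (at (x /\<^sub>R s))) (at (x /\<^sub>R s))"
  shows "grad (\<lambda>x. b * \<phi> (x /\<^sub>R s)) x = (b / s) *\<^sub>R grad \<phi> (x /\<^sub>R s)"
  unfolding grad_def frechet_derivative_dilate[OF assms] by (simp add: scaleR_sum_right)

lemma weak_grad_dilate:
  fixes u :: "'a::euclidean_space \<Rightarrow> real"
  assumes s: "0 < s" and u: "weak_grad \<Omega> u g"
  shows "weak_grad ((*\<^sub>R) s ` \<Omega>) (\<lambda>x. s * u (x /\<^sub>R s)) (\<lambda>x. g (x /\<^sub>R s))"
  unfolding weak_grad_def
proof (intro allI impI ballI conjI)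
  fix \<psi> :: "'a \<Rightarrow> real" and i :: 'a
  assume \<psi>: "test_fun ((*\<^sub>R) s ` \<Omega>) \<psi>" and i: "i \<in> Basis"
  define \<psi>' where "\<psi>' y = 1 * \<psi> (y /\<^sub>R inverse s)" for y
  have \<psi>'_test: "test_fun \<Omega> \<psi>'"
    using test_fun_dilate[OF \<psi>, of 1 "inverse s"] s
    by (simp add: \<psi>'_def[abs_def] scaleR_image_scaleR_image_inverse)
  have \<psi>'_deriv: "frechet_derivative \<psi>' (at y) i = s * frechet_derivative \<psi> (at (s *\<^sub>R y)) i" for y
    unfolding \<psi>'_def[abs_def] frechet_derivative_dilate[OF test_fun_has_derivative[OF \<psi>]]
    using s by (simp add: divide_inverse)
  from u \<psi>'_test i have I1: "set_integrable lebesgue \<Omega> (\<lambda>y. u y * frechet_derivative \<psi>' (at y) i)"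
    and I2: "set_integrable lebesgue \<Omega> (\<lambda>y. (g y \<bullet> i) * \<psi>' y)"
    and E: "(LINT y:\<Omega>|lebesgue. u y * frechet_derivative \<psi>' (at y) i)
              = - (LINT y:\<Omega>|lebesgue. (g y \<bullet> i) * \<psi>' y)"
    unfolding weak_grad_def by blast+
  have e1: "(\<lambda>y. s * u (s *\<^sub>R y /\<^sub>R s) * frechet_derivative \<psi> (at (s *\<^sub>R y)) i)
      = (\<lambda>y. u y * frechet_derivative \<psi>' (at y) i)"
    unfolding \<psi>'_deriv using s by (simp add: fun_eq_iff)
  have e2: "(\<lambda>y. (g (s *\<^sub>R y /\<^sub>R s) \<bullet> i) * \<psi> (s *\<^sub>R y)) = (\<lambda>y. (g y \<bullet> i) * \<psi>' y)"
    using s by (simp add: \<psi>'_def fun_eq_iff)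
  show "set_integrable lebesgue ((*\<^sub>R) s ` \<Omega>) (\<lambda>x. s * u (x /\<^sub>R s) * frechet_derivative \<psi> (at x) i)"
    unfolding set_integrable_dilate_iff[OF s] e1 by (rule I1)
  show "set_integrable lebesgue ((*\<^sub>R) s ` \<Omega>) (\<lambda>x. (g (x /\<^sub>R s) \<bullet> i) * \<psi> x)"
    unfolding set_integrable_dilate_iff[OF s] e2 by (rule I2)
  show "(LINT x:(*\<^sub>R) s ` \<Omega>|lebesgue. s * u (x /\<^sub>R s) * frechet_derivative \<psi> (at x) i)
      = - (LINT x:(*\<^sub>R) s ` \<Omega>|lebesgue. (g (x /\<^sub>R s) \<bullet> i) * \<psi> x)"
    unfolding set_integral_dilate[OF s] e1 e2 E by simp
qed

lemma W01p_dilate: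
  fixes u :: "'a::euclidean_space \<Rightarrow> real"
  assumes s: "0 < s" and u: "W01p \<Omega> p u g"
  shows "W01p ((*\<^sub>R) s ` \<Omega>) p (\<lambda>x. s * u (x /\<^sub>R s)) (\<lambda>x. g (x /\<^sub>R s))"
proof -
  from u obtain \<phi> :: "nat \<Rightarrow> 'a \<Rightarrow> real" where \<phi>: "\<And>n. test_fun \<Omega> (\<phi> n)"
    and lim: "(\<lambda>n. (LINT x:\<Omega>|lebesgue. \<bar>\<phi> n x - u x\<bar> powr p)
             + (LINT x:\<Omega>|lebesgue. norm (grad (\<phi> n) x - g x) powr p)) \<longlonglongrightarrow> 0"
    unfolding W01p_def by blast
  define X where "X n = (LINT x:\<Omega>|lebesgue. \<bar>\<phi> n x - u x\<bar> powr p)" for n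
  define Y where "Y n = (LINT x:\<Omega>|lebesgue. norm (grad (\<phi> n) x - g x) powr p)" for n
  define \<Phi> where "\<Phi> n x = s * \<phi> n (x /\<^sub>R s)" for n x
  have \<Phi>: "test_fun ((*\<^sub>R) s ` \<Omega>) (\<Phi> n)" for n
    using test_fun_dilate[OF \<phi> _ s, of s] s unfolding \<Phi>_def[abs_def] by simp
  have grad_\<Phi>: "grad (\<Phi> n) x = grad (\<phi> n) (x /\<^sub>R s)" for n x
    unfolding \<Phi>_def[abs_def] grad_dilate[OF test_fun_has_derivative[OF \<phi>]] using s by simp
  have X: "(LINT x:(*\<^sub>R) s ` \<Omega>|lebesgue. \<bar>\<Phi> n x - s * u (x /\<^sub>R s)\<bar> powr p) = s ^ DIM('a) * s powr p * X n"
    and Y: "(LINT x:(*\<^sub>R) s ` \<Omega>|lebesgue. norm (grad (\<Phi> n) x - g (x /\<^sub>R s)) powr p) = s ^ DIM('a) * Y n" for n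
    using s unfolding set_integral_dilate[OF s] X_def Y_def grad_\<Phi>
    by (simp_all add: \<Phi>_def right_diff_distrib[symmetric] abs_mult powr_mult)
  have XY: "0 \<le> X n" "0 \<le> Y n" for n
    unfolding X_def Y_def set_lebesgue_integral_def by (simp_all add: Bochner_Integration.integral_nonneg)
  define C where "C = s ^ DIM('a) * (s powr p + 1)"
  have "(\<lambda>n. s ^ DIM('a) * s powr p * X n + s ^ DIM('a) * Y n) \<longlonglongrightarrow> 0"
  proof (rule tendsto_sandwich[of "\<lambda>n. 0" _ _ "\<lambda>n. C * (X n + Y n)"])
    show "\<forall>\<^sub>F n in sequentially. s ^ DIM('a) * s powr p * X n + s ^ DIM('a) * Y n \<le> C * (X n + Y n)"
      using XY s by (auto simp: C_def algebra_simps intro!: add_mono mult_left_mono)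
    show "(\<lambda>n. C * (X n + Y n)) \<longlonglongrightarrow> 0"
      using tendsto_mult_right_zero[OF lim[folded X_def Y_def]] .
  qed (use XY s in auto)
  then have lim_\<Phi>: "(\<lambda>n. (LINT x:(*\<^sub>R) s ` \<Omega>|lebesgue. \<bar>\<Phi> n x - s * u (x /\<^sub>R s)\<bar> powr p)
        + (LINT x:(*\<^sub>R) s ` \<Omega>|lebesgue. norm (grad (\<Phi> n) x - g (x /\<^sub>R s)) powr p)) \<longlonglongrightarrow> 0"
    unfolding X Y .
  have "W1p ((*\<^sub>R) s ` \<Omega>) p (\<lambda>x. s * u (x /\<^sub>R s)) (\<lambda>x. g (x /\<^sub>R s))"
    using Lp_dilate[OF s, of \<Omega> p u s] Lp_dilate[OF s, of \<Omega> p g 1] weak_grad_dilate[OF s, of \<Omega> u g] u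
    by (simp add: W01p_def W1p_def)
  then show ?thesis
    unfolding W01p_def by (rule conjI[OF _ exI[of _ \<Phi>]]) (use \<Phi> lim_\<Phi> in simp)
qed

section \<open>Rayleigh quotients\<close>

definition rayleigh_quotients :: "'a::euclidean_space set \<Rightarrow> real \<Rightarrow> real \<Rightarrow> real \<Rightarrow> real \<Rightarrow> real set" where
  "rayleigh_quotients \<Omega> p q \<alpha> \<beta> = {((1/p) * (LINT x:\<Omega>|lebesgue. norm (gu x) powr p)
        + (1/q) * (LINT x:\<Omega>|lebesgue. norm (gv x) powr q))
        / (LINT x:\<Omega>|lebesgue. \<bar>u x\<bar> powr \<alpha> * \<bar>v x\<bar> powr \<beta>) | u gu v gv.
      W01p \<Omega> p u gu \<and> W01p \<Omega> q v gv \<and>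
      (LINT x:\<Omega>|lebesgue. \<bar>u x\<bar> powr \<alpha> * \<bar>v x\<bar> powr \<beta>) > 0}"

lemma lambda1_eq_Inf_rayleigh_quotients: "lambda1 \<Omega> p q \<alpha> \<beta> = Inf (rayleigh_quotients \<Omega> p q \<alpha> \<beta>)"
  by (simp add: lambda1_def rayleigh_quotients_def)

lemma rayleigh_quotients_nonneg:
  "z \<in> rayleigh_quotients \<Omega> p q \<alpha> \<beta> \<Longrightarrow> 0 < p \<Longrightarrow> 0 < q \<Longrightarrow> 0 \<le> z"
  unfolding rayleigh_quotients_def set_lebesgue_integral_def
  by (auto intro!: divide_nonneg_pos add_nonneg_nonneg mult_nonneg_nonneg Bochner_Integration.integral_nonneg)

lemma rayleigh_quotients_nonempty:
  fixes \<Omega> :: "'a::euclidean_space set"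
  assumes \<Omega>: "open \<Omega>" "bounded \<Omega>" "\<Omega> \<noteq> {}" and pq: "0 < p" "0 < q" and \<alpha>\<beta>: "0 < \<alpha>" "0 < \<beta>"
  shows "rayleigh_quotients \<Omega> p q \<alpha> \<beta> \<noteq> {}"
proof -
  obtain c r where r: "0 < r" "cball c r \<subseteq> \<Omega>"
    using \<Omega>(1,3) open_contains_cball by blast
  let ?\<phi> = "bump c r"
  have \<phi>: "test_fun \<Omega> ?\<phi>"
    by (rule test_fun_bump) (use r in auto)
  have sets: "\<Omega> \<in> sets lebesgue"
    using \<Omega>(1) by simp
  have cont: "continuous_on UNIV (\<lambda>x. \<bar>?\<phi> x\<bar> powr \<alpha> * \<bar>?\<phi> x\<bar> powr \<beta>)"
    using Ck_imp_continuous_on[OF Cinf_imp_Ck[OF Cinf_bump]] \<alpha>\<beta>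
    by (auto intro!: continuous_intros continuous_on_powr')
  have "0 < (LINT x:\<Omega>|lebesgue. \<bar>?\<phi> x\<bar> powr \<alpha> * \<bar>?\<phi> x\<bar> powr \<beta>)"
    using r bump_center_pos[OF r(1), of c]
    by (intro set_integral_pos_continuous[OF cont _ \<Omega>(1), of c]
        set_integrable_continuous_bounded[OF cont \<Omega>(2) sets]) auto
  then show ?thesis
    unfolding rayleigh_quotients_def
    using W01p_test_fun[OF \<phi> \<Omega>(2) sets pq(1)] W01p_test_fun[OF \<phi> \<Omega>(2) sets pq(2)] by blast
qed

lemma rayleigh_quotient_dilate:
  fixes \<Omega> :: "'a::euclidean_space set"
  assumes s: "0 < s" and z: "z \<in> rayleigh_quotients \<Omega> p q \<alpha> \<beta>"
  shows "z / s powr (\<alpha> + \<beta>) \<in> rayleigh_quotients ((*\<^sub>R) s ` \<Omega>) p q \<alpha> \<beta>"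
proof -
  from z obtain u gu v gv where u: "W01p \<Omega> p u gu" and v: "W01p \<Omega> q v gv"
    and D: "0 < (LINT x:\<Omega>|lebesgue. \<bar>u x\<bar> powr \<alpha> * \<bar>v x\<bar> powr \<beta>)"
    and z: "z = ((1/p) * (LINT x:\<Omega>|lebesgue. norm (gu x) powr p)
        + (1/q) * (LINT x:\<Omega>|lebesgue. norm (gv x) powr q))
        / (LINT x:\<Omega>|lebesgue. \<bar>u x\<bar> powr \<alpha> * \<bar>v x\<bar> powr \<beta>)"
    unfolding rayleigh_quotients_def by blast
  define A where "A = (LINT x:\<Omega>|lebesgue. norm (gu x) powr p)"
  define B where "B = (LINT x:\<Omega>|lebesgue. norm (gv x) powr q)"
  define C where "C = (LINT x:\<Omega>|lebesgue. \<bar>u x\<bar> powr \<alpha> * \<bar>v x\<bar> powr \<beta>)"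
  let ?s\<Omega> = "(*\<^sub>R) s ` \<Omega>"
  have A': "(LINT x:?s\<Omega>|lebesgue. norm (gu (x /\<^sub>R s)) powr p) = s ^ DIM('a) * A"
    and B': "(LINT x:?s\<Omega>|lebesgue. norm (gv (x /\<^sub>R s)) powr q) = s ^ DIM('a) * B"
    using s by (simp_all add: set_integral_dilate A_def B_def)
  have "\<bar>s * u y\<bar> powr \<alpha> * \<bar>s * v y\<bar> powr \<beta> = s powr (\<alpha> + \<beta>) * (\<bar>u y\<bar> powr \<alpha> * \<bar>v y\<bar> powr \<beta>)" for y
    using s by (simp add: abs_mult powr_mult powr_add)
  then have C': "(LINT x:?s\<Omega>|lebesgue. \<bar>s * u (x /\<^sub>R s)\<bar> powr \<alpha> * \<bar>s * v (x /\<^sub>R s)\<bar> powr \<beta>)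
      = s ^ DIM('a) * (s powr (\<alpha> + \<beta>) * C)"
    using s by (simp add: set_integral_dilate C_def)
  have pos: "0 < s ^ DIM('a)" "0 < s powr (\<alpha> + \<beta>)" "0 < C"
    using s D by (simp_all add: C_def)
  have val: "z / s powr (\<alpha> + \<beta>) = ((1/p) * (s ^ DIM('a) * A) + (1/q) * (s ^ DIM('a) * B))
      / (s ^ DIM('a) * (s powr (\<alpha> + \<beta>) * C))"
    unfolding z A_def[symmetric] B_def[symmetric] C_def[symmetric] using pos by (simp add: field_simps)
  show ?thesis
    unfolding rayleigh_quotients_def mem_Collect_eq
    apply (rule exI[of _ "\<lambda>x. s * u (x /\<^sub>R s)"], rule exI[of _ "\<lambda>x. gu (x /\<^sub>R s)"],
        rule exI[of _ "\<lambda>x. s * v (x /\<^sub>R s)"], rule exI[of _ "\<lambda>x. gv (x /\<^sub>R s)"])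
    unfolding A' B' C' val using W01p_dilate[OF s u] W01p_dilate[OF s v] pos by simp
qed

lemma rayleigh_quotients_dilate:
  fixes \<Omega> :: "'a::euclidean_space set"
  assumes s: "0 < s"
  shows "rayleigh_quotients ((*\<^sub>R) s ` \<Omega>) p q \<alpha> \<beta> = (\<lambda>z. z / s powr (\<alpha> + \<beta>)) ` rayleigh_quotients \<Omega> p q \<alpha> \<beta>"
proof
  show "(\<lambda>z. z / s powr (\<alpha> + \<beta>)) ` rayleigh_quotients \<Omega> p q \<alpha> \<beta> \<subseteq> rayleigh_quotients ((*\<^sub>R) s ` \<Omega>) p q \<alpha> \<beta>"
    using rayleigh_quotient_dilate[OF s] by blast
  show "rayleigh_quotients ((*\<^sub>R) s ` \<Omega>) p q \<alpha> \<beta> \<subseteq> (\<lambda>z. z / s powr (\<alpha> + \<beta>)) ` rayleigh_quotients \<Omega> p q \<alpha> \<beta>"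
  proof
    fix w assume "w \<in> rayleigh_quotients ((*\<^sub>R) s ` \<Omega>) p q \<alpha> \<beta>"
    from rayleigh_quotient_dilate[OF positive_imp_inverse_positive[OF s] this]
    have "w * s powr (\<alpha> + \<beta>) \<in> rayleigh_quotients \<Omega> p q \<alpha> \<beta>"
      using s by (simp add: scaleR_image_scaleR_image_inverse inverse_powr divide_inverse)
    moreover have "w = w * s powr (\<alpha> + \<beta>) / s powr (\<alpha> + \<beta>)"
      using s by simp
    ultimately show "w \<in> (\<lambda>z. z / s powr (\<alpha> + \<beta>)) ` rayleigh_quotients \<Omega> p q \<alpha> \<beta>"
      by blast
  qed
qed

lemma lambda1_dilate:
  fixes \<Omega> :: "'a::euclidean_space set"
  assumes s: "0 < s" and pq: "0 < p" "0 < q" and ne: "rayleigh_quotients \<Omega> p q \<alpha> \<beta> \<noteq> {}"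
  shows "s powr (\<alpha> + \<beta>) * lambda1 ((*\<^sub>R) s ` \<Omega>) p q \<alpha> \<beta> = lambda1 \<Omega> p q \<alpha> \<beta>"
proof -
  let ?R = "rayleigh_quotients \<Omega> p q \<alpha> \<beta>" and ?c = "s powr (\<alpha> + \<beta>)"
  have c: "0 < ?c"
    using s by simp
  have "bdd_below ?R"
    by (rule bdd_belowI[of _ 0]) (simp add: rayleigh_quotients_nonneg pq)
  then have "Inf ((\<lambda>z. z / ?c) ` ?R) = Inf ?R / ?c"
    using c ne by (intro continuous_at_Inf_mono[symmetric])
      (auto simp: mono_def divide_right_mono intro!: continuous_intros)
  then show ?thesis
    using c by (simp add: lambda1_eq_Inf_rayleigh_quotients rayleigh_quotients_dilate[OF s])
qed

theorem lemma3p1: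
  fixes p q \<alpha> \<beta> t :: real
  assumes "1 < p" and "1 < q" and "\<alpha> > 0" and "\<beta> > 0"
    and "\<alpha> / p + \<beta> / q = 1" and "t > 0"
  shows "t powr (\<alpha> + \<beta>) * lambda1 (cube t :: 'a::euclidean_space set) p q \<alpha> \<beta>
           = lambda1 (cube 1 :: 'a set) p q \<alpha> \<beta>"
proof -
  have "rayleigh_quotients (cube 1 :: 'a set) p q \<alpha> \<beta> \<noteq> {}"
    using assms by (intro rayleigh_quotients_nonempty) (auto simp: cube_def box_ne_empty)
  then have "t powr (\<alpha> + \<beta>) * lambda1 ((*\<^sub>R) t ` cube 1 :: 'a set) p q \<alpha> \<beta> = lambda1 (cube 1 :: 'a set) p q \<alpha> \<beta>"
    using assms by (intro lambda1_dilate) auto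
  then show ?thesis
    by (simp only: cube_eq_scaleR_image[OF \<open>t > 0\<close>])
qed

end
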